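(* The positional marked patterns $1\underline{2}3$ and $1\underline{3}2$ are $pmp$-Wilf equivalent; that is, for every $n\ge 1$, $$\sum_{\sigma\in S_n} x^{pmp_{1\underline{2}3}(\sigma)}=\sum_{\sigma\in S_n} x^{pmp_{1\underline{3}2}(\sigma)}.$$
   Context: A positional marked pattern of length $k$ is a permutation $\tau=\tau_1\cdots\tau_k$ of $[k]$ with exactly one entry underlined; $\pi(\tau)\in S_k$ is the permutation obtained by removing the underline and $u(\tau)$ is the position of the underlined entry. For a word $w$ with distinct letters, $red(w)$ replaces the $i$-th smallest letter by $i$. For $\sigma\in S_n$, $\sigma$ has a $\tau$-match at position $\ell$ if there are indices $i_1<\cdots<i_k$ with $i_{u(\tau)}=\ell$ and $red(\sigma_{i_1}\cdots\sigma_{i_k})=\pi(\tau)$. $pmp_\tau(\sigma)$ is the number of positions at which $\sigma$ has a $\tau$-match. Two positional marked patterns are $pmp$-Wilf equivalent if the polynomials $\sum_{\sigma\in S_n}x^{pmp_\tau(\sigma)}$ agree for all $n$. Here $1\underline{2}3$ has $\pi=123$, $u=2$, and $1\underline{3}2$ has $\pi=132$, $u=2$. *)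

theory Defs
  imports
    "HOL-Combinatorics.Multiset_Permutations"
    "HOL-Computational_Algebra.Polynomial"
begin

text \<open>
  Permutations are written in one-line notation, as lists of the letters \<open>1, \<dots>, n\<close>.
  Positions are counted from 1, so the letter at position \<open>i\<close> of \<open>w\<close> is \<open>w ! (i - 1)\<close>.
\<close>

abbreviation Sym :: "nat \<Rightarrow> nat list set" where
  "Sym n \<equiv> permutations_of_set {1..n}"

definition red :: "nat list \<Rightarrow> nat list" where
  "red w = map (\<lambda>a. card {b \<in> set w. b \<le> a}) w"

text \<open>\<open>underlying \<tau>\<close> is \<open>\<pi>(\<tau>)\<close> and \<open>underlined_pos \<tau>\<close> is \<open>u(\<tau>)\<close>.\<close>

datatype marked_pattern = Marked (underlying: "nat list") (underlined_pos: nat)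

definition positional_marked_pattern :: "marked_pattern \<Rightarrow> bool" where
  "positional_marked_pattern \<tau> \<longleftrightarrow>
     underlying \<tau> \<in> Sym (length (underlying \<tau>)) \<and>
     underlined_pos \<tau> \<in> {1..length (underlying \<tau>)}"

text \<open>The list \<open>is\<close> holds the indices \<open>i\<^sub>1 < \<dots> < i\<^sub>k\<close> of the occurrence.\<close>

definition has_match_at :: "marked_pattern \<Rightarrow> nat list \<Rightarrow> nat \<Rightarrow> bool" where
  "has_match_at \<tau> \<sigma> l \<longleftrightarrow>
     (\<exists>is. length is = length (underlying \<tau>) \<and>
           sorted_wrt (<) is \<and>
           set is \<subseteq> {1..length \<sigma>} \<and>
           is ! (underlined_pos \<tau> - 1) = l \<and>
           red (map (\<lambda>i. \<sigma> ! (i - 1)) is) = underlying \<tau>)"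

definition pmp :: "marked_pattern \<Rightarrow> nat list \<Rightarrow> nat" where
  "pmp \<tau> \<sigma> = card {l \<in> {1..length \<sigma>}. has_match_at \<tau> \<sigma> l}"

definition pmp_poly :: "marked_pattern \<Rightarrow> nat \<Rightarrow> int poly" where
  "pmp_poly \<tau> n = (\<Sum>\<sigma>\<in>Sym n. monom 1 (pmp \<tau> \<sigma>))"

definition pmp_Wilf_equivalent :: "marked_pattern \<Rightarrow> marked_pattern \<Rightarrow> bool" where
  "pmp_Wilf_equivalent \<tau> \<tau>' \<longleftrightarrow>
     positional_marked_pattern \<tau> \<and> positional_marked_pattern \<tau>' \<and>
     (\<forall>n\<ge>1. pmp_poly \<tau> n = pmp_poly \<tau>' n)"

end

theory Submission
  imports Defs
begin

text \<open>
  Read \<open>\<sigma>\<close> from left to right and let \<open>m\<close> be the minimum of the letters read so far. A new letter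
  below \<open>m\<close> is matched by neither pattern. A new letter \<open>x > m\<close> is matched by the first pattern iff
  it is not the largest, and by the second iff it is not the smallest, of the letters above \<open>m\<close> not
  read before.
  In both cases exactly one of the choices for \<open>x > m\<close> is unmatched, and the choice of such an \<open>x\<close>
  does not affect how many of the remaining letters are below or above \<open>m\<close>. Hence both generating
  functions satisfy the same recursion in the numbers of remaining letters below and above \<open>m\<close>.
\<close>

section \<open>The scanning statistic and its generating function\<close>

text \<open>Here \<open>R p x y\<close> stands for: the letters \<open>p\<close>, \<open>x\<close>,
  \<open>y\<close>, read in this order, form the pattern with \<open>x\<close> underlined. Only the
  running minimum \<open>m\<close> is tried as first letter.\<close>

fun scan_count :: "('a::linorder \<Rightarrow> 'a \<Rightarrow> 'a \<Rightarrow> bool) \<Rightarrow> 'a \<Rightarrow> 'a list \<Rightarrow> nat" where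
  "scan_count R m [] = 0"
| "scan_count R m (x # xs) =
     (if m < x then of_bool (\<exists>y\<in>set xs. R m x y) + scan_count R m xs else scan_count R x xs)"

text \<open>\<open>scan_poly N a\<close> belongs to \<open>N\<close> remaining letters, \<open>a\<close> of them below the current minimum.\<close>

primrec scan_poly :: "nat \<Rightarrow> nat \<Rightarrow> int poly" where
  "scan_poly 0 a = 1"
| "scan_poly (Suc N) a =
     (\<Sum>i<a. scan_poly N i) +
     (if a \<le> N then (of_nat (N - a) * monom 1 1 + 1) * scan_poly N a else 0)"

text \<open>Ranks increase strictly, hence are distinct, and they fill an initial segment of the
  right size. This lets a sum over the possible new minima be indexed by how many letters stay
  below.\<close>

lemma bij_betw_card_less:
  fixes A :: "'a::linorder set"
  assumes "finite A"
  shows "bij_betw (\<lambda>x. card {y\<in>A. y < x}) A {..<card A}"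
proof -
  have less: "card {y\<in>A. y < x} < card {y\<in>A. y < z}" if "x \<in> A" "x < z" for x z
  proof (rule psubset_card_mono)
    have "x \<in> {y\<in>A. y < z} - {y\<in>A. y < x}" and "{y\<in>A. y < x} \<subseteq> {y\<in>A. y < z}"
      using that by auto
    then show "{y\<in>A. y < x} \<subset> {y\<in>A. y < z}" by blast
  qed (use assms in simp)
  have inj: "inj_on (\<lambda>x. card {y\<in>A. y < x}) A"
  proof (rule inj_onI)
    fix x z
    assume "x \<in> A" "z \<in> A" "card {y\<in>A. y < x} = card {y\<in>A. y < z}"
    then show "x = z" using less[of x z] less[of z x] by (cases x z rule: linorder_cases) auto
  qed
  have "card {y\<in>A. y < x} < card A" if "x \<in> A" for x
    using that assms by (intro psubset_card_mono) auto
  then have "(\<lambda>x. card {y\<in>A. y < x}) ` A \<subseteq> {..<card A}" by auto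
  moreover have "card ((\<lambda>x. card {y\<in>A. y < x}) ` A) = card A"
    using inj by (rule card_image)
  ultimately have "(\<lambda>x. card {y\<in>A. y < x}) ` A = {..<card A}"
    by (intro card_subset_eq) auto
  with inj show ?thesis by (simp add: bij_betw_def)
qed

lemma sum_permutations_of_set:
  assumes "finite A" "A \<noteq> {}"
  shows "(\<Sum>w\<in>permutations_of_set A. f w) =
         (\<Sum>x\<in>A. \<Sum>w\<in>permutations_of_set (A - {x}). f (x # w))"
proof -
  have "(\<Sum>w\<in>permutations_of_set A. f w) =
        (\<Sum>x\<in>A. \<Sum>w\<in>(#) x ` permutations_of_set (A - {x}). f w)"
    unfolding permutations_of_set_nonempty[OF assms(2)]
    using assms(1) by (intro sum.UNION_disjoint) auto
  also have "\<dots> = (\<Sum>x\<in>A. \<Sum>w\<in>permutations_of_set (A - {x}). f (x # w))"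
    by (simp add: sum.reindex)
  finally show ?thesis .
qed

text \<open>Induction on the number of letters, splitting by the first one. The right-hand side does
  not mention \<open>R\<close>, so all relations satisfying \<open>one_unmatched\<close> give the
  same distribution.\<close>

lemma sum_scan_count_eq_scan_poly:
  fixes S :: "'a::linorder set"
  assumes one_unmatched: "\<And>m S. finite S \<Longrightarrow> {x\<in>S. m < x} \<noteq> {} \<Longrightarrow>
    \<exists>z. {x\<in>S. m < x \<and> \<not> (\<exists>y\<in>S - {x}. R m x y)} = {z}"
  assumes "finite S" "m \<notin> S"
  shows "(\<Sum>w\<in>permutations_of_set S. monom 1 (scan_count R m w)) =
         scan_poly (card S) (card {x\<in>S. x < m})"
  using assms(2,3)
proof (induction "card S" arbitrary: S m)
  case 0
  then show ?case by simp
next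
  case (Suc N)
  note fin = \<open>finite S\<close>
  define A where "A = {x\<in>S. x < m}"
  define B where "B = {x\<in>S. m < x}"
  have finA: "finite A" and finB: "finite B" using fin by (auto simp: A_def B_def)
  have S: "S = A \<union> B" and disj: "A \<inter> B = {}"
    using Suc.prems by (auto simp: A_def B_def not_less order.order_iff_strict)
  have cardS: "card A + card B = Suc N"
    using Suc.hyps(2) S disj finA finB by (simp add: card_Un_disjoint)
  have cardD: "card (S - {x}) = N" if "x \<in> S" for x
    using that Suc.hyps(2) fin by simp
  let ?M = "\<lambda>x. \<exists>y\<in>S - {x}. R m x y"
  let ?F = "\<lambda>x. \<Sum>w\<in>permutations_of_set (S - {x}). monom (1::int) (scan_count R m (x # w))"
  \<comment> \<open>The letter \<open>x\<close> becomes the new minimum, and its rank in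
    \<open>A\<close> is the new number of letters below.\<close>
  have below: "?F x = scan_poly N (card {y\<in>A. y < x})" if "x \<in> A" for x
  proof -
    from that have x: "x \<in> S" "x < m" by (auto simp: A_def)
    have "?F x = (\<Sum>w\<in>permutations_of_set (S - {x}). monom 1 (scan_count R x w))"
      using x by (intro sum.cong) auto
    also have "\<dots> = scan_poly (card (S - {x})) (card {y\<in>S - {x}. y < x})"
      using cardD[OF x(1)] fin by (intro Suc.hyps(1)) auto
    also have "{y\<in>S - {x}. y < x} = {y\<in>A. y < x}" using x by (auto simp: A_def)
    finally show ?thesis using cardD[OF x(1)] by simp
  qed
  \<comment> \<open>The minimum and \<open>A\<close> are unchanged. Whether \<open>x\<close> is
    matched depends only on the set \<open>S - {x}\<close> of later letters, not on their
    order.\<close>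
  have above: "?F x = (if ?M x then monom 1 1 else 1) * scan_poly N (card A)"
    if "x \<in> B" for x
  proof -
    from that have x: "x \<in> S" "m < x" by (auto simp: B_def)
    have "?F x = (\<Sum>w\<in>permutations_of_set (S - {x}).
                    (if ?M x then monom 1 1 else 1) * monom 1 (scan_count R m w))"
      using x by (intro sum.cong) (auto simp: mult_monom dest: permutations_of_setD)
    also have "\<dots> = (if ?M x then monom 1 1 else 1) *
                    (\<Sum>w\<in>permutations_of_set (S - {x}). monom 1 (scan_count R m w))"
      by (simp add: sum_distrib_left)
    also have "(\<Sum>w\<in>permutations_of_set (S - {x}). monom 1 (scan_count R m w)) =
               scan_poly (card (S - {x})) (card {y\<in>S - {x}. y < m})"
      using cardD[OF x(1)] fin Suc.prems(2) by (intro Suc.hyps(1)) auto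
    also have "{y\<in>S - {x}. y < m} = A" using x by (auto simp: A_def)
    finally show ?thesis using cardD[OF x(1)] by simp
  qed
  have sumA: "(\<Sum>x\<in>A. ?F x) = (\<Sum>i<card A. scan_poly N i)"
  proof -
    have "(\<Sum>x\<in>A. ?F x) = (\<Sum>x\<in>A. scan_poly N (card {y\<in>A. y < x}))"
      by (intro sum.cong refl below)
    also have "\<dots> = (\<Sum>i<card A. scan_poly N i)"
      by (rule sum.reindex_bij_betw[OF bij_betw_card_less[OF finA]])
    finally show ?thesis .
  qed
  \<comment> \<open>\<open>B\<close> has \<open>Suc N - card A\<close> letters: one has weight 1,
    the others weight \<open>monom 1 1\<close>. If \<open>B\<close> is empty, then
    \<open>card A = Suc N\<close> and the guard gives 0.\<close>
  have sumB: "(\<Sum>x\<in>B. ?F x) =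
    (if card A \<le> N then (of_nat (N - card A) * monom 1 1 + 1) * scan_poly N (card A) else 0)"
  proof (cases "B = {}")
    case True
    then show ?thesis using cardS by simp
  next
    case False
    then obtain z where z: "{x\<in>S. m < x \<and> \<not> ?M x} = {z}"
      using one_unmatched[of S m] fin unfolding B_def by blast
    then have zB: "z \<in> B" and Mz: "\<not> ?M z" by (auto simp: B_def)
    have M: "?M x" if "x \<in> B - {z}" for x
      using that z unfolding B_def by blast
    have "card B > 0" using zB finB by (auto simp: card_gt_0_iff)
    have "(\<Sum>x\<in>B. ?F x) = ?F z + (\<Sum>x\<in>B - {z}. ?F x)"
      using finB zB by (rule sum.remove)
    also have "(\<Sum>x\<in>B - {z}. ?F x) = (\<Sum>x\<in>B - {z}. monom 1 1 * scan_poly N (card A))"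
    proof (intro sum.cong refl)
      fix x assume x: "x \<in> B - {z}"
      with M[OF x] above[of x]
      show "?F x = monom 1 1 * scan_poly N (card A)" by simp
    qed
    also have "\<dots> = of_nat (card B - 1) * (monom 1 1 * scan_poly N (card A))"
      using finB zB by simp
    also have "?F z = scan_poly N (card A)" using above[OF zB] Mz by simp
    also have "card B - 1 = N - card A" using cardS by simp
    finally show ?thesis using cardS \<open>card B > 0\<close> by (simp add: algebra_simps)
  qed
  have "(\<Sum>w\<in>permutations_of_set S. monom 1 (scan_count R m w)) = (\<Sum>x\<in>S. ?F x)"
    using fin Suc.hyps(2) by (intro sum_permutations_of_set) auto
  also have "\<dots> = (\<Sum>x\<in>A. ?F x) + (\<Sum>x\<in>B. ?F x)"
    unfolding S by (rule sum.union_disjoint[OF finA finB disj])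
  also have "\<dots> = scan_poly (Suc N) (card A)"
    unfolding sumA sumB by simp
  finally show ?case using Suc.hyps(2) by (simp add: A_def)
qed

section \<open>The scan as a count of positions\<close>

text \<open>By \<open>anti\<close>, if some earlier letter can start an occurrence, so can the
  smallest one; by \<open>gt\<close>, a letter not above the minimum never matches. The initial
  \<open>m\<close> acts as a letter in front of \<open>w\<close>, and positions count from
  0.\<close>

lemma scan_count_eq_card:
  assumes gt: "\<And>p x y. R p x y \<Longrightarrow> p < x"
    and anti: "\<And>p q x y. R p x y \<Longrightarrow> q \<le> p \<Longrightarrow> R q x y"
  shows "scan_count R m w =
    card {l. l < length w \<and>
             (\<exists>p\<in>insert m (set (take l w)). \<exists>y\<in>set (drop (Suc l) w). R p (w ! l) y)}"
proof (induction w arbitrary: m)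
  case Nil
  then show ?case by simp
next
  case (Cons x xs)
  let ?Q = "\<lambda>m w l. \<exists>p\<in>insert m (set (take l w)). \<exists>y\<in>set (drop (Suc l) w). R p (w ! l) y"
  let ?m = "if m < x then m else x"
  \<comment> \<open>The candidates \<open>m\<close> and \<open>x\<close> can be replaced by the
    smaller of the two.\<close>
  have Q_Suc: "?Q m (x # xs) (Suc k) \<longleftrightarrow> ?Q ?m xs k" for k
  proof (cases "m < x")
    case True
    then have "R x u v \<Longrightarrow> R m u v" for u v by (auto intro: anti)
    with True show ?thesis by auto
  next
    case False
    then have "R m u v \<Longrightarrow> R x u v" for u v by (auto intro: anti)
    with False show ?thesis by auto
  qed
  have zero: "?Q m (x # xs) 0 \<longleftrightarrow> m < x \<and> (\<exists>y\<in>set xs. R m x y)"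
    by (auto dest: gt)
  have split: "{l. l < length (x # xs) \<and> ?Q m (x # xs) l} =
    (if ?Q m (x # xs) 0 then {0} else {}) \<union> Suc ` {l. l < length xs \<and> ?Q ?m xs l}"
    (is "?L = ?Z \<union> Suc ` ?T")
  proof (rule set_eqI)
    fix l show "l \<in> ?L \<longleftrightarrow> l \<in> ?Z \<union> Suc ` ?T"
    proof (cases l)
      case 0
      then show ?thesis by auto
    next
      case (Suc k)
      have "l \<in> ?L \<longleftrightarrow> k < length xs \<and> ?Q m (x # xs) (Suc k)" by (simp add: Suc)
      also have "\<dots> \<longleftrightarrow> k \<in> ?T" unfolding Q_Suc by simp
      finally show ?thesis using Suc by auto
    qed
  qed
  have "card (?Z \<union> Suc ` ?T) = card ?Z + card (Suc ` ?T)"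
    by (intro card_Un_disjoint) auto
  also have "card (Suc ` ?T) = card ?T" by (intro card_image) auto
  also have "card ?T = scan_count R ?m xs" by (rule Cons.IH[symmetric])
  finally show ?case unfolding split zero by auto
qed

section \<open>From pattern matches to the scan\<close>

lemma card_le_less_iff:
  fixes A :: "'a::linorder set"
  assumes "finite A" "y \<in> A"
  shows "card {b\<in>A. b \<le> x} < card {b\<in>A. b \<le> y} \<longleftrightarrow> x < y"
proof
  assume "x < y"
  then have "{b\<in>A. b \<le> x} \<subseteq> {b\<in>A. b \<le> y}" "y \<in> {b\<in>A. b \<le> y} - {b\<in>A. b \<le> x}"
    using assms(2) by auto
  then have "{b\<in>A. b \<le> x} \<subset> {b\<in>A. b \<le> y}" by blast
  then show "card {b\<in>A. b \<le> x} < card {b\<in>A. b \<le> y}"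
    using assms(1) by (intro psubset_card_mono) auto
next
  assume less: "card {b\<in>A. b \<le> x} < card {b\<in>A. b \<le> y}"
  show "x < y"
  proof (rule ccontr)
    assume "\<not> x < y"
    then have "card {b\<in>A. b \<le> y} \<le> card {b\<in>A. b \<le> x}"
      using assms(1) by (intro card_mono) auto
    with less show False by simp
  qed
qed

text \<open>Prescribed ranks determine the order of the letters by \<open>card_le_less_iff\<close>;
  conversely the order determines each set of letters up to a given one.\<close>

lemma red_eq_123_iff: "red [a, b, c] = [1, 2, 3] \<longleftrightarrow> a < b \<and> b < c"
proof
  assume "red [a, b, c] = [1, 2, 3]"
  then have "card {y\<in>{a, b, c}. y \<le> a} = 1" "card {y\<in>{a, b, c}. y \<le> b} = 2"
    "card {y\<in>{a, b, c}. y \<le> c} = 3" by (simp_all only: red_def list.map list.set list.inject)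
  then show "a < b \<and> b < c"
    using card_le_less_iff[of "{a, b, c}" b a] card_le_less_iff[of "{a, b, c}" c b]
    by (simp del: Collect_disj_eq insert_iff add: insertI1 insertI2)
next
  assume "a < b \<and> b < c"
  then have "{y\<in>{a, b, c}. y \<le> a} = {a}" "{y\<in>{a, b, c}. y \<le> b} = {a, b}"
    "{y\<in>{a, b, c}. y \<le> c} = {a, b, c}" and "a \<noteq> b" "a \<noteq> c" "b \<noteq> c" by auto
  then show "red [a, b, c] = [1, 2, 3]"
    by (simp only: red_def list.map list.set list.inject) simp
qed

lemma red_eq_132_iff: "red [a, b, c] = [1, 3, 2] \<longleftrightarrow> a < c \<and> c < b"
proof
  assume "red [a, b, c] = [1, 3, 2]"
  then have "card {y\<in>{a, b, c}. y \<le> a} = 1" "card {y\<in>{a, b, c}. y \<le> b} = 3"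
    "card {y\<in>{a, b, c}. y \<le> c} = 2" by (simp_all only: red_def list.map list.set list.inject)
  then show "a < c \<and> c < b"
    using card_le_less_iff[of "{a, b, c}" c a] card_le_less_iff[of "{a, b, c}" b c]
    by (simp del: Collect_disj_eq insert_iff add: insertI1 insertI2)
next
  assume "a < c \<and> c < b"
  then have "{y\<in>{a, b, c}. y \<le> a} = {a}" "{y\<in>{a, b, c}. y \<le> b} = {a, b, c}"
    "{y\<in>{a, b, c}. y \<le> c} = {a, c}" and "a \<noteq> b" "a \<noteq> c" "b \<noteq> c" by auto
  then show "red [a, b, c] = [1, 3, 2]"
    by (simp only: red_def list.map list.set list.inject) simp
qed

text \<open>An upper bound \<open>m\<close> of all letters is a harmless start for the scan: by
  \<open>gt\<close> it never begins an occurrence.\<close>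

lemma pmp_eq_scan_count:
  assumes red: "\<And>a b c. red [a, b, c] = \<pi> \<longleftrightarrow> R a b c"
    and len: "length \<pi> = 3"
    and gt: "\<And>p x y. R p x y \<Longrightarrow> p < x"
    and anti: "\<And>p q x y. R p x y \<Longrightarrow> q \<le> p \<Longrightarrow> R q x y"
    and m: "\<And>x. x \<in> set \<sigma> \<Longrightarrow> x \<le> m"
  shows "pmp (Marked \<pi> 2) \<sigma> = scan_count R m \<sigma>"
proof -
  let ?Q = "\<lambda>l. \<exists>p\<in>insert m (set (take l \<sigma>)). \<exists>y\<in>set (drop (Suc l) \<sigma>). R p (\<sigma> ! l) y"
  have match: "has_match_at (Marked \<pi> 2) \<sigma> (Suc l) \<longleftrightarrow> ?Q l" if l: "l < length \<sigma>" for l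
  proof
    assume "has_match_at (Marked \<pi> 2) \<sigma> (Suc l)"
    then obtain js where js: "length js = 3" "sorted_wrt (<) js" "set js \<subseteq> {1..length \<sigma>}"
      "js ! 1 = Suc l" "red (map (\<lambda>i. \<sigma> ! (i - 1)) js) = \<pi>"
      by (auto simp: has_match_at_def len)
    then obtain i k where "js = [i, Suc l, k]"
      by (auto simp: length_Suc_conv numeral_3_eq_3)
    with js have i: "1 \<le> i" "i < Suc l" and k: "Suc l < k" "k \<le> length \<sigma>"
      and R: "R (\<sigma> ! (i - 1)) (\<sigma> ! l) (\<sigma> ! (k - 1))" by (auto simp: red)
    have "\<sigma> ! (i - 1) \<in> set (take l \<sigma>)"
      unfolding in_set_conv_nth using i l by (intro exI[of _ "i - 1"]) auto
    moreover have "\<sigma> ! (k - 1) \<in> set (drop (Suc l) \<sigma>)"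
      unfolding in_set_conv_nth using k l
      by (intro exI[of _ "k - 1 - Suc l"]) (auto simp: Suc_diff_Suc numeral_2_eq_2)
    ultimately show "?Q l" using R by blast
  next
    assume "?Q l"
    then obtain p y where p: "p \<in> insert m (set (take l \<sigma>))"
      and y: "y \<in> set (drop (Suc l) \<sigma>)" and R: "R p (\<sigma> ! l) y" by blast
    have "p \<noteq> m" using gt[OF R] m[of "\<sigma> ! l"] l by auto
    with p obtain i where i: "i < l" "p = \<sigma> ! i" using l by (auto simp: in_set_conv_nth)
    from y obtain k where k: "k < length \<sigma> - Suc l" "y = \<sigma> ! (Suc l + k)"
      by (auto simp: in_set_conv_nth)
    show "has_match_at (Marked \<pi> 2) \<sigma> (Suc l)"
      unfolding has_match_at_def using i k l R
      \<comment> \<open>The positions, counted from 1, of \<open>p\<close>, the underlined letter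
        and \<open>y\<close>.\<close>
      by (intro exI[of _ "[Suc i, Suc l, Suc (Suc l + k)]"]) (auto simp: len red)
  qed
  have "{l \<in> {1..length \<sigma>}. has_match_at (Marked \<pi> 2) \<sigma> l} =
        Suc ` {l. l < length \<sigma> \<and> ?Q l}" (is "?L = Suc ` ?T")
  proof (rule set_eqI)
    fix l show "l \<in> ?L \<longleftrightarrow> l \<in> Suc ` ?T"
      using match by (cases l) (auto simp: image_iff Suc_le_eq)
  qed
  then have "pmp (Marked \<pi> 2) \<sigma> = card ?T"
    unfolding pmp_def by (simp add: card_image)
  also have "\<dots> = scan_count R m \<sigma>"
    using gt anti by (intro scan_count_eq_card[symmetric])
  finally show ?thesis .
qed

text \<open>Starting from the minimum \<open>Suc n\<close> puts all \<open>n\<close> letters below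
  it, which explains both arguments of \<open>scan_poly n n\<close>.\<close>

lemma pmp_poly_eq_scan_poly:
  assumes red: "\<And>a b c. red [a, b, c] = \<pi> \<longleftrightarrow> R a b c"
    and len: "length \<pi> = 3"
    and gt: "\<And>p x y. R p x y \<Longrightarrow> p < x"
    and anti: "\<And>p q x y. R p x y \<Longrightarrow> q \<le> p \<Longrightarrow> R q x y"
    and one_unmatched: "\<And>m S. finite S \<Longrightarrow> {x\<in>S. m < x} \<noteq> {} \<Longrightarrow>
      \<exists>z. {x\<in>S. m < x \<and> \<not> (\<exists>y\<in>S - {x}. R m x y)} = {z}"
  shows "pmp_poly (Marked \<pi> 2) n = scan_poly n n"
proof -
  have "pmp_poly (Marked \<pi> 2) n = (\<Sum>\<sigma>\<in>Sym n. monom 1 (scan_count R (Suc n) \<sigma>))"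
    unfolding pmp_poly_def
  proof (intro sum.cong refl)
    fix \<sigma> assume "\<sigma> \<in> Sym n"
    then have "set \<sigma> = {1..n}" by (rule permutations_of_setD)
    then show "monom 1 (pmp (Marked \<pi> 2) \<sigma>) = monom (1::int) (scan_count R (Suc n) \<sigma>)"
      by (subst pmp_eq_scan_count[OF red len gt anti, where m = "Suc n"]) auto
  qed
  also have "\<dots> = scan_poly (card {1..n}) (card {x\<in>{1..n}. x < Suc n})"
    using one_unmatched by (intro sum_scan_count_eq_scan_poly) auto
  also have "{x\<in>{1..n}. x < Suc n} = {1..n}" by auto
  finally show ?thesis by simp
qed

section \<open>The single unmatched choice for each pattern\<close>

text \<open>The largest letter has no larger one after it, while any other letter above
  \<open>m\<close> has this one. The form is that of \<open>one_unmatched\<close> with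
  \<open>R m x y\<close> read as \<open>m < x \<and> x < y\<close>.\<close>

lemma only_Max_unmatched:
  fixes S :: "'a::linorder set"
  assumes "finite S" "{x\<in>S. m < x} \<noteq> {}"
  shows "\<exists>z. {x\<in>S. m < x \<and> \<not> (\<exists>y\<in>S - {x}. m < x \<and> x < y)} = {z}"
proof -
  define z where "z = Max {x\<in>S. m < x}"
  have z: "z \<in> S" "m < z" using Max_in[of "{x\<in>S. m < x}"] assms by (auto simp: z_def)
  have ub: "x \<le> z" if "x \<in> S" "m < x" for x
    unfolding z_def using that assms by (intro Max_ge) auto
  have "{x\<in>S. m < x \<and> \<not> (\<exists>y\<in>S - {x}. m < x \<and> x < y)} = {z}"
  proof (intro equalityI subsetI)
    fix x assume x: "x \<in> {x\<in>S. m < x \<and> \<not> (\<exists>y\<in>S - {x}. m < x \<and> x < y)}"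
    then have "x \<le> z" "\<not> x < z" using ub z by auto
    then show "x \<in> {z}" by simp
  next
    fix x assume "x \<in> {z}"
    then show "x \<in> {x\<in>S. m < x \<and> \<not> (\<exists>y\<in>S - {x}. m < x \<and> x < y)}"
      using z ub by (force dest: leD less_trans)
  qed
  then show ?thesis by blast
qed

text \<open>Dually, the smallest letter above \<open>m\<close> serves as the last letter of an
  occurrence for every other choice, but has none for itself.\<close>

lemma only_Min_unmatched:
  fixes S :: "'a::linorder set"
  assumes "finite S" "{x\<in>S. m < x} \<noteq> {}"
  shows "\<exists>z. {x\<in>S. m < x \<and> \<not> (\<exists>y\<in>S - {x}. m < y \<and> y < x)} = {z}"
proof -
  define z where "z = Min {x\<in>S. m < x}"
  have z: "z \<in> S" "m < z" using Min_in[of "{x\<in>S. m < x}"] assms by (auto simp: z_def)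
  have lb: "z \<le> x" if "x \<in> S" "m < x" for x
    unfolding z_def using that assms by (intro Min_le) auto
  have "{x\<in>S. m < x \<and> \<not> (\<exists>y\<in>S - {x}. m < y \<and> y < x)} = {z}"
  proof (intro equalityI subsetI)
    fix x assume x: "x \<in> {x\<in>S. m < x \<and> \<not> (\<exists>y\<in>S - {x}. m < y \<and> y < x)}"
    then have "z \<le> x" "\<not> z < x" using lb z by auto
    then show "x \<in> {z}" by simp
  next
    fix x assume "x \<in> {z}"
    then show "x \<in> {x\<in>S. m < x \<and> \<not> (\<exists>y\<in>S - {x}. m < y \<and> y < x)}"
      using z lb by (auto dest: leD)
  qed
  then show ?thesis by blast
qed

theorem theorem2:
  shows "pmp_Wilf_equivalent (Marked [1, 2, 3] 2) (Marked [1, 3, 2] 2)"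
proof -
  have "positional_marked_pattern (Marked [1, 2, 3] 2)"
    and "positional_marked_pattern (Marked [1, 3, 2] 2)"
    by (auto simp: positional_marked_pattern_def permutations_of_set_def)
  moreover have "pmp_poly (Marked [1, 2, 3] 2) n = scan_poly n n" for n
    by (rule pmp_poly_eq_scan_poly[OF red_eq_123_iff _ _ _ only_Max_unmatched]) auto
  moreover have "pmp_poly (Marked [1, 3, 2] 2) n = scan_poly n n" for n
    by (rule pmp_poly_eq_scan_poly[OF red_eq_132_iff _ _ _ only_Min_unmatched]) auto
  ultimately show ?thesis by (simp add: pmp_Wilf_equivalent_def)
qed

end
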